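(* Let $G$ be a connected graph and let $\ell(G)$ be the length of the longest path in $G$. Then the number of distinct positive roots of $\mathcal{LM}(G,x)$ is at least $\ell(G)$. Also, if $\delta(G)\geq 2$, then $\mathcal{LM}(G,x)$ has at least $\ell(G)+1$ distinct positive roots.
   Context: All graphs are finite, undirected, without loops or multiple edges. $V(G)$ and $E(G)$ are the vertex and edge sets, $d_G(v)$ is the degree of $v$ in $G$, and $\delta(G)$ is the minimum degree of $G$. The length of a path is its number of edges. A matching of $G$ is a set $M\subseteq E(G)$ (possibly empty) no two distinct edges of which share an endpoint; $V(M)$ is the set of endpoints of edges in $M$. The Laplacian matching polynomial of $G$ is $$\mathcal{LM}(G,x)=\sum_{M}(-1)^{|M|}\prod_{v\in V(G)\setminus V(M)}\big(x-d_G(v)\big),$$ where $M$ ranges over all matchings of $G$. *)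

theory Defs
  imports
    Complex_Main
    "HOL-Computational_Algebra.Polynomial"
    "Graph_Theory.Graph_Theory"
begin

text \<open>
  A finite simple undirected graph is a finite symmetric digraph without loops and without
  parallel arcs (locale \<open>graph\<close> of the library). Each undirected edge is thus represented by a
  pair of opposite arcs; \<open>edges_of\<close> collapses such a pair to one two-element set.
\<close>

definition edges_of :: "('a, 'b) pre_digraph \<Rightarrow> 'a set set" where
  "edges_of G = (\<lambda>e. {tail G e, head G e}) ` arcs G"

text \<open>
  By symmetry and the absence of loops and parallel arcs, the arcs leaving \<open>v\<close> correspond
  one-to-one to the edges at \<open>v\<close>. So the degree is the out-degree (not the sum of in-degree
  and out-degree).
\<close>

definition vertex_degree :: "('a, 'b) pre_digraph \<Rightarrow> 'a \<Rightarrow> nat" where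
  "vertex_degree G v = out_degree G v"

text \<open>Meaningful only if \<open>G\<close> has a vertex; connected digraphs of the library do.\<close>

definition min_degree :: "('a, 'b) pre_digraph \<Rightarrow> nat" where
  "min_degree G = Min (vertex_degree G ` verts G)"

definition is_matching :: "('a, 'b) pre_digraph \<Rightarrow> 'a set set \<Rightarrow> bool" where
  "is_matching G M \<longleftrightarrow>
     M \<subseteq> edges_of G \<and> (\<forall>e\<in>M. \<forall>f\<in>M. e \<noteq> f \<longrightarrow> e \<inter> f = {})"

text \<open>Here \<open>\<Union>M\<close> is the set of endpoints of the matching and \<open>[:- d, 1:]\<close> is \<open>x - d\<close>.\<close>

definition laplacian_matching_poly :: "('a, 'b) pre_digraph \<Rightarrow> real poly" where
  "laplacian_matching_poly G =
     (\<Sum>M | is_matching G M.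
        (- 1) ^ card M * (\<Prod>v\<in>verts G - \<Union>M. [:- real (vertex_degree G v), 1:]))"

text \<open>
  A \<open>vpath\<close> is a nonempty walk without repeated vertices, and \<open>vwalk_length\<close> counts its edges;
  in particular a single vertex is a path of length 0.
\<close>

definition longest_path_length :: "('a, 'b) pre_digraph \<Rightarrow> nat" where
  "longest_path_length G = Max {vwalk_length p | p. vpath p G}"

end

theory Submission
  imports Defs
begin

text \<open>
  For a vertex set \<open>W\<close> let \<open>\<mu>(W)\<close> be the matching polynomial of the subgraph induced by \<open>W\<close> with
  vertex weights \<open>x - a\<^sub>v\<close>, where \<open>a\<^sub>v\<close> is the degree in the whole graph. Deleting \<open>v\<close> gives
  \<open>\<mu>(W)/\<mu>(W-v) = x - a\<^sub>v - (\<Sum>u. \<mu>(W-v-u)/\<mu>(W-v))\<close>, the sum ranging over the neighbours of \<open>v\<close>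
  in \<open>W\<close>. By induction every \<open>\<mu>(W-v-u)/\<mu>(W-v)\<close> is a sum of terms \<open>w/(x - z)\<close> with \<open>w > 0\<close>, so the
  right-hand side is a function with \<open>k\<close> poles and \<open>k + 1\<close> real zeros whose reciprocal is again such
  a sum. Hence along a path each vertex contributes a new zero, and \<open>\<mu>(V)\<close> has at least as many
  distinct real roots as a path has vertices.

  For \<open>x = -t \<le> 0\<close> the same recurrence shows that \<open>(-1)\<^bsup>|W|\<^esup> \<mu>(W)(-t)\<close> is positive if
  \<open>t > 0\<close> or all degrees are at least 2. So all roots are nonnegative, and 0 can be a root only
  if there is a vertex of degree at most 1.
\<close>

section \<open>Polynomials determined by finitely many zeros or values\<close>

text \<open>In the difference of the two monic polynomials the leading terms cancel, so its degree
  is below \<open>card Z\<close>, yet it would vanish on all of \<open>Z\<close>.\<close>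

lemma prod_linear_eqI:
  fixes p :: "real poly"
  assumes fin: "finite Z" and deg: "degree p = card Z" and lead: "lead_coeff p = 1"
    and zero: "\<And>z. z \<in> Z \<Longrightarrow> poly p z = 0"
  shows "p = (\<Prod>z\<in>Z. [:-z, 1:])"
proof (rule ccontr)
  let ?q = "\<Prod>z\<in>Z. [:-z, 1:]"
  assume neq: "p \<noteq> ?q"
  have degq: "degree ?q = card Z"
    by (subst degree_prod_eq_sum_degree) auto
  have leadq: "lead_coeff ?q = 1"
    by (simp add: lead_coeff_prod)
  have "card Z > 0"
  proof (rule ccontr)
    assume "\<not> card Z > 0"
    then have "Z = {}" "degree p = 0" using fin deg by auto
    then show False using neq lead by (auto elim!: degree_eq_zeroE)
  qed
  moreover have "degree (p - ?q) \<le> card Z"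
    using degree_diff_le[of p "card Z" ?q] deg degq by simp
  moreover have "coeff (p - ?q) (card Z) = 0"
    using lead leadq deg degq by simp
  ultimately have "degree (p - ?q) < card Z"
    by (metis eq_zero_or_degree_less degree_0)
  moreover have "card Z \<le> card {x. poly (p - ?q) x = 0}"
    using neq by (intro card_mono poly_roots_finite) (auto simp: zero fin poly_prod)
  ultimately show False
    using card_poly_roots_bound[of "p - ?q"] neq by simp
qed

lemma poly_eqI_card_roots:
  fixes p q :: "real poly"
  assumes fin: "finite Z" and "degree p < card Z" "degree q < card Z"
    and eq: "\<And>z. z \<in> Z \<Longrightarrow> poly p z = poly q z"
  shows "p = q"
proof (rule ccontr)
  assume neq: "p \<noteq> q"
  have "card Z \<le> card {x. poly (p - q) x = 0}"
    using neq by (intro card_mono poly_roots_finite) (auto simp: eq)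
  also have "\<dots> \<le> degree (p - q)"
    using card_poly_roots_bound[of "p - q"] neq by simp
  also have "\<dots> < card Z"
    using assms(2,3) by (simp add: degree_diff_less)
  finally show False by simp
qed

section \<open>Pick functions with finitely many poles, their zeros and reciprocals\<close>

text \<open>These are Pick (Nevanlinna) functions: they map the upper half plane to itself if \<open>m > 0\<close>.\<close>

definition pick :: "real \<Rightarrow> (real \<Rightarrow> real) \<Rightarrow> real set \<Rightarrow> real \<Rightarrow> real" where
  "pick c m S x = x - c - (\<Sum>s\<in>S. m s / (x - s))"

lemma isCont_pick: "finite S \<Longrightarrow> x \<notin> S \<Longrightarrow> isCont (pick c m S) x"
  unfolding pick_def[abs_def] by (auto intro!: continuous_intros)

lemma pick_split:
  "finite S \<Longrightarrow> s \<in> S \<Longrightarrow> pick c m S x = pick c m (S - {s}) x - m s / (x - s)"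
  unfolding pick_def by (subst sum.remove[of S s]) auto

text \<open>The substitution of \<open>-x\<close> for \<open>x\<close> negates the constant and the
  poles and keeps the weights. It turns behaviour right of a pole or at \<open>at_top\<close> into
  behaviour left of a pole or at \<open>at_bot\<close>.\<close>

lemma pick_reflect:
  "pick c m S x = - pick (- c) (\<lambda>s. m (- s)) (uminus ` S) (- x)"
proof -
  have "(\<Sum>s\<in>uminus ` S. m (- s) / (- x - s)) = (\<Sum>s\<in>S. m s / (s - x))"
    by (subst sum.reindex) (auto simp: inj_on_def)
  also have "\<dots> = - (\<Sum>s\<in>S. m s / (x - s))"
    by (simp add: minus_divide_right flip: sum_negf)
  finally show ?thesis by (simp add: pick_def)
qed

text \<open>Near \<open>s\<close> the other terms stay below \<open>?g s + 1\<close>, while the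
  split-off term \<open>m s / (x - s)\<close> grows without bound.\<close>

lemma pick_neg_right:
  assumes "finite S" "s \<in> S" "m s > 0"
  shows "\<forall>\<^sub>F x in at_right s. pick c m S x < 0"
proof -
  let ?g = "pick c m (S - {s})"
  have "isCont ?g s" using assms by (intro isCont_pick) auto
  then have g: "(?g \<longlongrightarrow> ?g s) (at_right s)"
    by (simp add: isCont_def filterlim_at_split)
  have "filterlim (\<lambda>x. m s * inverse (x - s)) at_top (at_right s)"
    using \<open>m s > 0\<close>
    by (intro filterlim_tendsto_pos_mult_at_top[of _ "m s"] tendsto_const
        filterlim_compose[OF filterlim_inverse_at_top_right] filterlim_at_withinI)
      (auto intro!: tendsto_eq_intros simp: eventually_at_filter)
  then have "\<forall>\<^sub>F x in at_right s. m s * inverse (x - s) \<ge> ?g s + 1"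
    by (simp add: filterlim_at_top)
  moreover have "\<forall>\<^sub>F x in at_right s. ?g x < ?g s + 1"
    using g by (rule order_tendstoD) simp
  ultimately show ?thesis
    by eventually_elim (simp add: pick_split[OF assms(1,2)] divide_inverse)
qed

lemma pick_pos_left:
  assumes "finite S" "s \<in> S" "m s > 0"
  shows "\<forall>\<^sub>F x in at_left s. pick c m S x > 0"
proof -
  have "\<forall>\<^sub>F x in at_right (- s). pick (- c) (\<lambda>s. m (- s)) (uminus ` S) x < 0"
    using assms by (intro pick_neg_right) auto
  then show ?thesis
    by (simp add: pick_reflect[of c m S] eventually_at_left_to_right[of _ "s"])
qed

lemma pick_at_top:
  assumes "finite S" shows "\<forall>\<^sub>F x in at_top. pick c m S x > 0"
proof -
  have "((\<lambda>x. \<Sum>s\<in>S. m s / (x - s)) \<longlongrightarrow> (\<Sum>s\<in>S. 0)) at_top"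
    by (intro tendsto_sum tendsto_divide_0[OF tendsto_const]
        filterlim_at_top_imp_at_infinity filterlim_at_top_add_at_top) 
      (simp add: filterlim_tendsto_add_at_top[OF tendsto_const filterlim_ident, of "- _", simplified])
  then have "\<forall>\<^sub>F x in at_top. (\<Sum>s\<in>S. m s / (x - s)) < 1"
    by (intro order_tendstoD) auto
  moreover have "\<forall>\<^sub>F x in at_top. x > c + 1" by (rule eventually_gt_at_top)
  ultimately show ?thesis by eventually_elim (simp add: pick_def)
qed

lemma pick_at_bot:
  assumes "finite S" shows "\<forall>\<^sub>F x in at_bot. pick c m S x < 0"
proof -
  show ?thesis
    using pick_at_top[of "uminus ` S" "-c" "\<lambda>s. m (-s)"] assms
    by (simp add: pick_reflect[of c m S] at_bot_mirror eventually_filtermap)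
qed

lemma pick_ivt:
  assumes "finite S" "a \<le> b" "{a..b} \<inter> S = {}" "pick c m S a < 0" "pick c m S b > 0"
  shows "\<exists>z. a \<le> z \<and> z \<le> b \<and> pick c m S z = 0"
  using assms by (intro IVT) (auto intro!: isCont_pick)

text \<open>The poles cut the line into \<open>card S + 1\<close> open intervals. On each of them
  the function is negative near the left end and positive near the right end, so each contains a
  zero.\<close>

lemma pick_zeros:
  assumes fin: "finite S" and pos: "\<And>s. s \<in> S \<Longrightarrow> m s > 0"
  shows "\<exists>Z. finite Z \<and> card Z = Suc (card S) \<and> Z \<inter> S = {} \<and> (\<forall>z\<in>Z. pick c m S z = 0)"
proof -
  \<comment> \<open>The zero assigned to \<open>s\<close> lies in the interval that starts at
    \<open>s\<close>; the last conjunct keeps it before the next pole.\<close>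
  have right: "\<exists>z>s. pick c m S z = 0 \<and> z \<notin> S \<and> (\<forall>s'\<in>S. s < s' \<longrightarrow> z < s')" if s: "s \<in> S" for s
  proof (cases "\<exists>s'\<in>S. s < s'")
    case False
    obtain b where b: "b > s" "pick c m S b > 0"
      using eventually_happens'[OF _ eventually_conj[OF pick_at_top[OF fin, of c m] eventually_gt_at_top[of s]]]
      by auto
    have "\<forall>\<^sub>F x in at_right s. s < x \<and> x < b"
      using b by (intro eventually_conj eventually_at_right_less) (auto simp: eventually_at_right)
    from eventually_happens'[OF _ eventually_conj[OF pick_neg_right[of S s m, OF fin s pos[OF s]] this]]
    obtain a where a: "s < a" "a < b" "pick c m S a < 0" by auto
    have "\<exists>z. a \<le> z \<and> z \<le> b \<and> pick c m S z = 0"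
      using a b False fin by (intro pick_ivt) force+
    then obtain z where z: "a \<le> z" "pick c m S z = 0" by blast
    then show ?thesis using a False by (intro exI[of _ z]) auto
  next
    case True
    define t where "t = Min {s'\<in>S. s < s'}"
    have "t \<in> {s'\<in>S. s < s'}" unfolding t_def using True fin by (intro Min_in) auto
    then have t: "t \<in> S" "s < t" by auto
    have tmin: "t \<le> s'" if "s' \<in> S" "s < s'" for s' unfolding t_def using that fin by (intro Min_le) auto
    have "\<forall>\<^sub>F x in at_left t. s < x \<and> x < t"
      using t by (auto simp: eventually_at_left)
    from eventually_happens'[OF _ eventually_conj[OF pick_pos_left[of S t m, OF fin t(1) pos[OF t(1)]] this]]
    obtain b where b: "s < b" "b < t" "pick c m S b > 0" by auto
    have "\<forall>\<^sub>F x in at_right s. s < x \<and> x < b"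
      using b by (auto simp: eventually_at_right)
    from eventually_happens'[OF _ eventually_conj[OF pick_neg_right[of S s m, OF fin s pos[OF s]] this]]
    obtain a where a: "s < a" "a < b" "pick c m S a < 0" by auto
    have "\<exists>z. a \<le> z \<and> z \<le> b \<and> pick c m S z = 0"
      using a b tmin fin by (intro pick_ivt) force+
    then obtain z where z: "a \<le> z" "z \<le> b" "pick c m S z = 0" by blast
    have "z < s'" if "s' \<in> S" "s < s'" for s' using tmin[OF that] z b by simp
    moreover from this have "z \<notin> S" using a z by force
    ultimately show ?thesis using a z by (intro exI[of _ z]) auto
  qed
  then obtain f where f: "\<And>s. s \<in> S \<Longrightarrow> s < f s \<and> pick c m S (f s) = 0 \<and> f s \<notin> S \<and> (\<forall>s'\<in>S. s < s' \<longrightarrow> f s < s')"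
    by metis
  \<comment> \<open>This is the zero in the unbounded interval on the left, which is the whole line
    if there are no poles.\<close>
  have left: "\<exists>z. pick c m S z = 0 \<and> (\<forall>s\<in>S. z < s)"
  proof (cases "S = {}")
    case True then show ?thesis by (intro exI[of _ c]) (simp add: pick_def)
  next
    case False
    define t where "t = Min S"
    have t: "t \<in> S" unfolding t_def using False fin by (intro Min_in) auto
    have tmin: "t \<le> s'" if "s' \<in> S" for s' unfolding t_def using that fin by (intro Min_le) auto
    obtain a where a: "a < t" "pick c m S a < 0"
      using eventually_happens'[OF _ eventually_conj[OF pick_at_bot[OF fin, of c m] eventually_gt_at_bot[of t]]]
      by auto
    have "\<forall>\<^sub>F x in at_left t. a < x \<and> x < t"
      using a by (auto simp: eventually_at_left)
    from eventually_happens'[OF _ eventually_conj[OF pick_pos_left[of S t m, OF fin t(1) pos[OF t(1)]] this]]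
    obtain b where b: "a < b" "b < t" "pick c m S b > 0" by auto
    have "\<exists>z. a \<le> z \<and> z \<le> b \<and> pick c m S z = 0"
      using a b tmin fin by (intro pick_ivt) force+
    then obtain z where z: "a \<le> z" "z \<le> b" "pick c m S z = 0" by blast
    have "z < s" if "s \<in> S" for s using tmin[OF that] z b by simp
    then show ?thesis using z by blast
  qed
  then obtain z0 where z0: "pick c m S z0 = 0" "\<And>s. s \<in> S \<Longrightarrow> z0 < s" by auto
  have inj: "inj_on f S"
  proof (rule linorder_inj_onI)
    fix s s' assume "s < s'" "s \<in> S" "s' \<in> S"
    \<comment> \<open>The pole \<open>s'\<close> separates the two zeros.\<close>
    then have "f s < s'" "s' < f s'" using f by blast+
    then show "f s \<noteq> f s'" by simp
  qed auto
  have "z0 \<notin> f ` S" using f z0 by force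
  then have "card (insert z0 (f ` S)) = Suc (card S)"
    using fin inj by (simp add: card_image)
  then show ?thesis
    using fin f z0 by (intro exI[of _ "insert z0 (f ` S)"]) auto
qed

text \<open>Over a common denominator the function is \<open>N / D\<close> with \<open>N\<close>
  monic of degree \<open>card S + 1\<close>. The zeros from \<open>pick_zeros\<close> are that many,
  so \<open>N\<close> splits into distinct linear factors and \<open>D / N\<close> has a partial
  fraction expansion with simple poles. Its residues are positive because the derivative of
  \<open>pick c m S\<close> is at least 1 off the poles.\<close>

lemma pick_inverse:
  assumes fin: "finite S" and pos: "\<And>s. s \<in> S \<Longrightarrow> m s > 0"
  shows "\<exists>Z w. finite Z \<and> card Z = Suc (card S) \<and> Z \<inter> S = {} \<and>
    (\<forall>z\<in>Z. w z > 0 \<and> pick c m S z = 0) \<and>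
    (\<forall>x. x \<notin> S \<union> Z \<longrightarrow> pick c m S x * (\<Sum>z\<in>Z. w z / (x - z)) = 1)"
proof -
  obtain Z where Z: "finite Z" "card Z = Suc (card S)" "Z \<inter> S = {}" "\<And>z. z \<in> Z \<Longrightarrow> pick c m S z = 0"
    using pick_zeros[of S m c] fin pos by auto
  define D where "D = (\<Prod>s\<in>S. [:-s, 1:])"
  define N where "N = [:-c, 1:] * D - (\<Sum>s\<in>S. smult (m s) (\<Prod>s'\<in>S-{s}. [:-s', 1:]))"
  \<comment> \<open>\<open>R z\<close> is \<open>N\<close> without the factor for \<open>z\<close>,
    once \<open>N\<close> is known to be the product over \<open>Z\<close>.\<close>
  define R where "R = (\<lambda>z. \<Prod>z'\<in>Z-{z}. [:-z', 1:])"
  \<comment> \<open>the residue of \<open>1 / pick c m S\<close> at \<open>z\<close>, the reciprocal of the derivative\<close>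
  define w where "w = (\<lambda>z. 1 / (1 + (\<Sum>s\<in>S. m s / (z - s)^2)))"
  have degD: "degree D = card S" unfolding D_def by (subst degree_prod_eq_sum_degree) auto
  have leadD: "lead_coeff D = 1" unfolding D_def by (simp add: lead_coeff_prod)
  have Dz: "poly D x \<noteq> 0" if "x \<notin> S" for x
    using that fin by (auto simp: D_def poly_prod)
  have ND: "poly N x = pick c m S x * poly D x" if "x \<notin> S" for x
  proof -
    have "poly (\<Prod>s'\<in>S-{s}. [:-s', 1:]) x = poly D x / (x - s)" if "s \<in> S" for s
    proof -
      have "x \<noteq> s" using that \<open>x \<notin> S\<close> by auto
      moreover have "poly D x = (x - s) * poly (\<Prod>s'\<in>S-{s}. [:-s', 1:]) x"
        unfolding D_def using that fin by (subst prod.remove[of S s]) (auto simp: algebra_simps)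
      ultimately show ?thesis by simp
    qed
    then show ?thesis
      by (simp add: N_def pick_def poly_sum algebra_simps sum_distrib_left)
  qed
  have degM: "degree ([:-c, 1:] * D) = Suc (card S)"
    using leadD degD by (subst degree_mult_eq) auto
  have degT: "degree (\<Sum>s\<in>S. smult (m s) (\<Prod>s'\<in>S-{s}. [:-s', 1:])) < Suc (card S)"
  proof -
    have "degree (\<Sum>s\<in>S. smult (m s) (\<Prod>s'\<in>S-{s}. [:-s', 1:])) \<le> card S"
    proof (intro degree_sum_le fin)
      fix s assume "s \<in> S"
      have "degree (\<Prod>s'\<in>S-{s}. [:-s', 1:]) = card (S - {s})"
        by (subst degree_prod_eq_sum_degree) auto
      also have "\<dots> \<le> card S" using fin by (intro card_mono) auto
      finally show "degree (smult (m s) (\<Prod>s'\<in>S-{s}. [:-s', 1:])) \<le> card S"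
        using degree_smult_le le_trans by blast
    qed
    then show ?thesis by simp
  qed
  have "degree N = card Z"
  proof -
    have "degree N = degree ([:-c, 1:] * D)"
      unfolding N_def diff_conv_add_uminus using degM degT by (intro degree_add_eq_left) simp
    then show ?thesis using degM Z by simp
  qed
  moreover have "lead_coeff N = 1"
  proof -
    have "coeff N (Suc (card S)) = coeff ([:-c, 1:] * D) (Suc (card S))"
      unfolding N_def coeff_diff using coeff_eq_0[OF degT] by simp
    also have "\<dots> = lead_coeff ([:-c, 1:] * D)" using degM by simp
    also have "\<dots> = 1" using leadD by (simp only: lead_coeff_mult) simp
    finally show ?thesis using \<open>degree N = card Z\<close> Z by simp
  qed
  ultimately have N: "N = (\<Prod>z\<in>Z. [:-z, 1:])"
    using Z ND by (intro prod_linear_eqI) (auto simp: disjoint_iff)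
  have NR: "N = [:-z, 1:] * R z" if "z \<in> Z" for z
    unfolding N R_def using that Z by (simp add: prod.remove)
  \<comment> \<open>The derivative of \<open>N\<close> at \<open>z\<close> is computed twice: from
    \<open>N = pick * D\<close>, where the term with the derivative of \<open>D\<close> vanishes
    since \<open>z\<close> is a zero of \<open>pick\<close>, and from
    \<open>N = (x - z) * R z\<close>.\<close>
  have key: "poly D z = w z * poly (R z) z" if z: "z \<in> Z" for z
  proof -
    have zS: "z \<notin> S" using z Z by auto
    have "(poly N has_field_derivative poly (pderiv N) z) (at z)" by (rule poly_DERIV)
    then have "((\<lambda>x. pick c m S x * poly D x) has_field_derivative poly (pderiv N) z) (at z)"
    proof (rule has_field_derivative_transform_within_open[where S = "- S"])
      show "open (- S)" using fin by (simp add: finite_imp_closed open_Compl)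
    qed (use zS ND in auto)
    moreover have "((\<lambda>x. pick c m S x * poly D x) has_field_derivative
        (1 + (\<Sum>s\<in>S. m s / (z - s)^2)) * poly D z) (at z)"
    proof -
      have "(pick c m S has_field_derivative (1 - (\<Sum>s\<in>S. - (m s / (z - s)^2)))) (at z)"
        unfolding pick_def[abs_def] using zS
        by (auto intro!: derivative_eq_intros simp: power2_eq_square)
      from DERIV_mult[OF this poly_DERIV[of D z]] show ?thesis
        using Z z by (simp add: sum_negf)
    qed
    ultimately have "poly (pderiv N) z = (1 + (\<Sum>s\<in>S. m s / (z - s)^2)) * poly D z"
      by (rule DERIV_unique)
    moreover have "poly (pderiv N) z = poly (R z) z"
      unfolding NR[OF z] pderiv_mult by (simp add: pderiv_pCons)
    moreover have "1 + (\<Sum>s\<in>S. m s / (z - s)^2) > 0"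
      using pos by (intro add_pos_nonneg sum_nonneg) (auto simp: less_imp_le)
    ultimately show ?thesis by (simp add: w_def)
  qed
  \<comment> \<open>Lagrange interpolation at the points of \<open>Z\<close>: both sides have degree
    at most \<open>card S\<close>, one less than the number of points.\<close>
  have DR: "D = (\<Sum>z\<in>Z. smult (w z) (R z))"
  proof (rule poly_eqI_card_roots[OF Z(1)])
    have "degree (\<Sum>z\<in>Z. smult (w z) (R z)) \<le> card S"
    proof (intro degree_sum_le Z)
      fix z assume "z \<in> Z"
      have "degree (R z) = card (Z - {z})"
        unfolding R_def by (subst degree_prod_eq_sum_degree) auto
      also have "\<dots> = card S" using Z \<open>z \<in> Z\<close> by simp
      finally show "degree (smult (w z) (R z)) \<le> card S"
        using degree_smult_le le_trans by metis
    qed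
    then show "degree (\<Sum>z\<in>Z. smult (w z) (R z)) < card Z" using Z by simp
    show "degree D < card Z" using degD Z by simp
    fix z assume z: "z \<in> Z"
    have "poly (R z') z = 0" if "z' \<in> Z" "z' \<noteq> z" for z'
      unfolding R_def using that z Z by (auto simp: poly_prod)
    then have "(\<Sum>z'\<in>Z. w z' * poly (R z') z) = (\<Sum>z'\<in>Z. if z' = z then w z * poly (R z) z else 0)"
      by (intro sum.cong) auto
    also have "\<dots> = w z * poly (R z) z" using Z z by simp
    finally show "poly D z = poly (\<Sum>z\<in>Z. smult (w z) (R z)) z"
      using key[OF z] by (simp add: poly_sum)
  qed
  have inv: "pick c m S x * (\<Sum>z\<in>Z. w z / (x - z)) = 1" if x: "x \<notin> S \<union> Z" for x
  proof -
    have Nx: "poly N x \<noteq> 0" using x Z by (auto simp: N poly_prod)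
    have "poly (R z) x = poly N x / (x - z)" if "z \<in> Z" for z
    proof -
      have "poly N x = (x - z) * poly (R z) x" by (subst NR[OF that]) (simp add: algebra_simps)
      moreover have "x \<noteq> z" using x that by auto
      ultimately show ?thesis by simp
    qed
    then have "poly D x = poly N x * (\<Sum>z\<in>Z. w z / (x - z))"
      by (subst DR) (simp add: poly_sum sum_distrib_left mult_ac)
    then show ?thesis using ND[of x] x Nx Dz[of x] by (simp add: field_simps)
  qed
  have "w z > 0" for z
    unfolding w_def using pos by (intro divide_pos_pos add_pos_nonneg sum_nonneg) (auto simp: less_imp_le)
  then show ?thesis using Z inv by blast
qed

text \<open>The point \<open>x\<close> may itself belong to \<open>F\<close>. Both sides are
  continuous there and agree on a punctured neighbourhood, as the rest of \<open>F\<close> is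
  closed.\<close>

lemma poly_eq_off_finite:
  fixes p :: "real poly"
  assumes F: "finite F" and f: "isCont f x" and eq: "\<And>y. y \<notin> F \<Longrightarrow> poly p y = f y"
  shows "poly p x = f x"
proof (rule tendsto_unique[of "at x"])
  show "(poly p \<longlongrightarrow> poly p x) (at x)"
    using poly_isCont[of x p] by (simp add: isCont_def)
  have "open (- (F - {x}))" using F by (intro open_Compl finite_imp_closed) auto
  then have "\<forall>\<^sub>F y in at x. y \<in> - (F - {x}) \<and> y \<noteq> x"
    unfolding eventually_at_topological by blast
  then have "\<forall>\<^sub>F y in at x. f y = poly p y"
    by eventually_elim (auto simp: eq)
  with f show "(poly p \<longlongrightarrow> f x) (at x)"
    unfolding isCont_def by (rule Lim_transform_eventually)
qed simp

section \<open>Weighted matching polynomials and their vertex recurrence\<close>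

text \<open>The edge set is fixed and the vertex set is an argument, so vertices can be deleted in
  an induction while the weights keep referring to the whole graph.\<close>

locale edge_set =
  fixes E :: "'a set set"
  assumes card_edge: "e \<in> E \<Longrightarrow> card e = 2"
begin

definition nbrs :: "'a \<Rightarrow> 'a set" where
  "nbrs v = {u. {v, u} \<in> E}"

definition matchings :: "'a set \<Rightarrow> 'a set set set" where
  "matchings W = {M. M \<subseteq> E \<and> pairwise disjnt M \<and> \<Union>M \<subseteq> W}"

definition match_poly :: "('a \<Rightarrow> real) \<Rightarrow> 'a set \<Rightarrow> real poly" where
  "match_poly a W = (\<Sum>M\<in>matchings W. (- 1) ^ card M * (\<Prod>v\<in>W - \<Union>M. [:- a v, 1:]))"

lemma nbrs_sym: "u \<in> nbrs v \<longleftrightarrow> v \<in> nbrs u"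
  by (simp add: nbrs_def insert_commute)

lemma nbrs_irrefl: "v \<notin> nbrs v"
  using card_edge[of "{v}"] by (auto simp: nbrs_def)

lemma finite_matchings: "finite W \<Longrightarrow> finite (matchings W)"
  by (rule finite_subset[of _ "Pow (Pow W)"]) (auto simp: matchings_def)

lemma finite_matching: "finite W \<Longrightarrow> M \<in> matchings W \<Longrightarrow> finite M"
  by (rule finite_subset[of _ "Pow W"]) (auto simp: matchings_def)

lemma matchings_empty: "matchings {} = {{}}"
proof -
  have "M = {}" if "M \<subseteq> E" "\<Union>M \<subseteq> {}" for M
    using that card_edge by fastforce
  then show ?thesis by (auto simp: matchings_def)
qed

lemma match_poly_empty: "match_poly a {} = 1"
  by (simp add: match_poly_def matchings_empty)

text \<open>A matching either misses \<open>v\<close> or covers it by exactly one edge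
  \<open>{v, u}\<close>; without that edge it is a matching that avoids both ends.\<close>

lemma matchings_split:
  assumes "v \<in> W"
  shows "matchings W = matchings (W - {v}) \<union>
    (\<Union>u\<in>nbrs v \<inter> W. insert {v, u} ` matchings (W - {v} - {u}))"
proof (intro equalityI subsetI)
  fix M assume M: "M \<in> matchings W"
  show "M \<in> matchings (W - {v}) \<union> (\<Union>u\<in>nbrs v \<inter> W. insert {v, u} ` matchings (W - {v} - {u}))"
  proof (cases "v \<in> \<Union>M")
    case False
    then show ?thesis using M by (auto simp: matchings_def)
  next
    case True
    then obtain e where e: "e \<in> M" "v \<in> e" by auto
    then have "card e = 2" using M card_edge by (auto simp: matchings_def)
    then obtain u where u: "e = {v, u}"
      using \<open>v \<in> e\<close> by (auto simp: card_2_iff)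
    have "u \<in> nbrs v \<inter> W" using M e u by (auto simp: matchings_def nbrs_def)
    moreover have "M - {e} \<in> matchings (W - {v} - {u})"
    proof -
      have "f \<inter> e = {}" if "f \<in> M - {e}" for f
        using M that e by (auto simp: matchings_def pairwise_def disjnt_def)
      then show ?thesis using M u by (auto simp: matchings_def pairwise_def)
    qed
    ultimately show ?thesis using e u by (auto intro!: bexI[of _ u] image_eqI[of _ _ "M - {e}"])
  qed
next
  fix M assume "M \<in> matchings (W - {v}) \<union> (\<Union>u\<in>nbrs v \<inter> W. insert {v, u} ` matchings (W - {v} - {u}))"
  then consider "M \<in> matchings (W - {v})"
    | u M' where "u \<in> nbrs v" "u \<in> W" "M = insert {v, u} M'" "M' \<in> matchings (W - {v} - {u})"
    by blast
  then show "M \<in> matchings W"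
  proof cases
    case 1 then show ?thesis by (auto simp: matchings_def)
  next
    case 2
    then have "disjnt {v, u} f" "disjnt f {v, u}" if "f \<in> M'" for f
      using that by (auto simp: matchings_def disjnt_def)
    then show ?thesis using 2 assms by (auto simp: matchings_def nbrs_def pairwise_insert)
  qed
qed

text \<open>Matchings are sorted by the edge that covers \<open>v\<close>. An uncovered
  \<open>v\<close> contributes the factor \<open>x - a v\<close>, and a covering edge contributes
  the sign \<open>-1\<close>.\<close>

lemma match_poly_rec:
  assumes fin: "finite W" and v: "v \<in> W"
  shows "match_poly a W = [:- a v, 1:] * match_poly a (W - {v}) - (\<Sum>u\<in>nbrs v \<inter> W. match_poly a (W - {v} - {u}))"
proof -
  let ?f = "\<lambda>M. (- 1) ^ card M * (\<Prod>v\<in>W - \<Union>M. [:- a v, 1:]) :: real poly"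
  let ?A = "\<lambda>u. insert {v, u} ` matchings (W - {v} - {u})"
  have "match_poly a W = sum ?f (matchings (W - {v})) + sum ?f (\<Union>u\<in>nbrs v \<inter> W. ?A u)"
    unfolding match_poly_def matchings_split[OF v] using fin
    by (intro sum.union_disjoint finite_UN_I finite_imageI finite_matchings) (auto simp: matchings_def)
  also have "sum ?f (\<Union>u\<in>nbrs v \<inter> W. ?A u) = (\<Sum>u\<in>nbrs v \<inter> W. sum ?f (?A u))"
  proof (intro sum.UNION_disjoint ballI impI)
    fix u u' assume uu: "u \<in> nbrs v \<inter> W" "u' \<in> nbrs v \<inter> W" "u \<noteq> u'"
    then have "u \<noteq> v" using nbrs_irrefl by auto
    \<comment> \<open>A common matching would contain both \<open>{v, u}\<close> and
      \<open>{v, u'}\<close>, although its part besides \<open>{v, u'}\<close> avoids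
      \<open>v\<close>.\<close>
    show "?A u \<inter> ?A u' = {}"
    proof (rule ccontr)
      assume "?A u \<inter> ?A u' \<noteq> {}"
      then obtain M where M: "insert {v, u} M \<in> ?A u'" by auto
      then obtain M' where "insert {v, u} M = insert {v, u'} M'" "M' \<in> matchings (W - {v} - {u'})" by auto
      moreover from this have "{v, u} \<notin> M'" by (auto simp: matchings_def)
      ultimately show False using uu \<open>u \<noteq> v\<close> by (auto simp: doubleton_eq_iff)
    qed
  qed (use fin in \<open>auto intro: finite_matchings\<close>)
  also have "(\<Sum>u\<in>nbrs v \<inter> W. sum ?f (?A u)) = (\<Sum>u\<in>nbrs v \<inter> W. - match_poly a (W - {v} - {u}))"
  proof (rule sum.cong[OF refl])
    fix u assume u: "u \<in> nbrs v \<inter> W"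
    have notin: "{v, u} \<notin> M" if "M \<in> matchings (W - {v} - {u})" for M
      using that by (auto simp: matchings_def)
    have inj: "inj_on (insert {v, u}) (matchings (W - {v} - {u}))"
    proof (rule inj_onI)
      fix M M' assume "M \<in> matchings (W - {v} - {u})" "M' \<in> matchings (W - {v} - {u})"
        "insert {v, u} M = insert {v, u} M'"
      then show "M = M'" using notin by (simp add: insert_ident)
    qed
    have "?f (insert {v, u} M) = - ((- 1) ^ card M * (\<Prod>v\<in>W - {v} - {u} - \<Union>M. [:- a v, 1:]))"
      if M: "M \<in> matchings (W - {v} - {u})" for M
    proof -
      have "card (insert {v, u} M) = Suc (card M)"
        using notin[OF M] finite_matching[OF _ M] fin by simp
      moreover have "W - \<Union>(insert {v, u} M) = W - {v} - {u} - \<Union>M" by auto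
      ultimately show ?thesis by simp
    qed
    then show "sum ?f (?A u) = - match_poly a (W - {v} - {u})"
      by (simp add: sum.reindex[OF inj] match_poly_def sum_negf)
  qed
  also have "sum ?f (matchings (W - {v})) = [:- a v, 1:] * match_poly a (W - {v})"
  proof -
    have "?f M = [:- a v, 1:] * ((- 1) ^ card M * (\<Prod>v\<in>W - {v} - \<Union>M. [:- a v, 1:]))"
      if M: "M \<in> matchings (W - {v})" for M
    proof -
      have "W - \<Union>M = insert v (W - {v} - \<Union>M)" using M v by (auto simp: matchings_def)
      then have "(\<Prod>v\<in>W - \<Union>M. [:- a v, 1:]) = [:- a v, 1:] * (\<Prod>v\<in>W - {v} - \<Union>M. [:- a v, 1:])"
        using fin by (metis (no_types, lifting) DiffD1 Diff_iff finite_Diff insertI1 prod.insert)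
      then show ?thesis by (simp only: mult.left_commute)
    qed
    then show ?thesis unfolding match_poly_def sum_distrib_left by (intro sum.cong) auto
  qed
  finally show ?thesis by (simp add: sum_negf)
qed

section \<open>Sign of the matching polynomial at nonpositive arguments\<close>

text \<open>
  The strict growth of \<open>f\<close> at vertices with a neighbour outside \<open>W\<close> is what makes the induction work:
  once \<open>v\<close> is deleted, all its neighbours are such vertices.
\<close>

lemma match_poly_nonpos_sign:
  fixes t :: real
  assumes V: "finite V" and E: "\<And>v. v \<in> V \<Longrightarrow> nbrs v \<subseteq> V"
    and t: "t \<ge> 0" "t > 0 \<or> (\<forall>v\<in>V. 2 \<le> card (nbrs v))"
    and W: "W \<subseteq> V"
  defines "a \<equiv> \<lambda>v. real (card (nbrs v))"
  defines "f \<equiv> \<lambda>W. (- 1) ^ card W * poly (match_poly a W) (- t)"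
  shows "f W > 0 \<and> (\<forall>v\<in>W. \<not> nbrs v \<subseteq> W \<longrightarrow> f (W - {v}) < f W)"
  using W
proof (induction "card W" arbitrary: W rule: less_induct)
  case less
  have fin: "finite W" using less.prems V finite_subset by auto
  have step: "f W > 0 \<and> (\<not> nbrs v \<subseteq> W \<longrightarrow> f (W - {v}) < f W)" if v: "v \<in> W" for v
  proof -
    let ?W = "W - {v}" and ?N = "nbrs v \<inter> W"
    have finv: "finite (nbrs v)" using E[of v] v less.prems V finite_subset by blast
    have cW: "card W = Suc (card ?W)" using v fin by (metis card.remove)
    have IH: "f ?W > 0" "\<And>u. u \<in> ?W \<Longrightarrow> \<not> nbrs u \<subseteq> ?W \<Longrightarrow> f (?W - {u}) < f ?W"
      using less.hyps[of ?W] less.prems cW by auto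
    have lt: "f (?W - {u}) < f ?W" if "u \<in> ?N" for u
    proof (rule IH(2))
      show "u \<in> ?W" using that nbrs_irrefl by auto
      show "\<not> nbrs u \<subseteq> ?W" using that nbrs_sym[of u v] by auto
    qed
    have "f W = (t + a v) * f ?W - (\<Sum>u\<in>?N. f (?W - {u}))"
    proof -
      have "(- 1) ^ card W * poly (match_poly a (?W - {u})) (- t) = f (?W - {u})" if "u \<in> ?N" for u
      proof -
        have "u \<in> ?W" using that nbrs_irrefl by auto
        then have "card ?W = Suc (card (?W - {u}))" using fin by (metis card.remove finite_Diff)
        then show ?thesis by (simp add: f_def cW)
      qed
      then have "(\<Sum>u\<in>?N. f (?W - {u})) = (- 1) ^ card W * (\<Sum>u\<in>?N. poly (match_poly a (?W - {u})) (- t))"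
        by (simp add: sum_distrib_left)
      then show ?thesis
        unfolding f_def match_poly_rec[OF fin v] by (simp add: poly_sum cW algebra_simps)
    qed
    \<comment> \<open>One copy of \<open>f ?W\<close> is moved next to each term of the sum. The
      differences are positive by \<open>lt\<close>, and \<open>a v - real (card ?N)\<close> counts
      the neighbours of \<open>v\<close> outside \<open>W\<close>.\<close>
    also have "\<dots> = (t + (a v - real (card ?N))) * f ?W + (\<Sum>u\<in>?N. f ?W - f (?W - {u}))"
      by (simp add: sum_subtractf algebra_simps)
    finally have eq: "f W = \<dots>" .
    have sum0: "(\<Sum>u\<in>?N. f ?W - f (?W - {u})) \<ge> 0"
      using lt by (intro sum_nonneg) (simp add: less_imp_le)
    have sum1: "(\<Sum>u\<in>?N. f ?W - f (?W - {u})) > 0" if "?N \<noteq> {}"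
      using lt finv that by (intro sum_pos) auto
    have cN: "card ?N \<le> card (nbrs v)" using finv by (intro card_mono) auto
    have t2: "t > 0 \<or> a v \<ge> 2" using t v less.prems unfolding a_def by force
    define k where "k = a v - real (card ?N)"
    have k0: "k \<ge> 0" using cN unfolding k_def a_def by simp
    have e: "f W = (t + k) * f ?W + (\<Sum>u\<in>?N. f ?W - f (?W - {u}))" unfolding k_def by (rule eq)
    have mono: "c * f ?W \<le> (t + k) * f ?W" if "c \<le> t + k" for c
      using that IH(1) by (intro mult_right_mono) auto
    have pos: "f W > 0"
    \<comment> \<open>If \<open>?N\<close> is empty, then \<open>k = a v\<close>, and the
      coefficient \<open>t + k\<close> is positive by \<open>t2\<close>. If \<open>t = 0\<close> and
      \<open>?N\<close> is nonempty, positivity comes from the sum instead.\<close>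
    proof (cases "t > 0 \<or> ?N = {}")
      case True
      have "t + k > 0" using True t2 t k0 unfolding k_def by auto
      then show ?thesis using e IH(1) sum0 by (simp add: add_pos_nonneg)
    next
      case False
      then show ?thesis using e sum1 mono[of 0] t k0 by simp
    qed
    moreover have "f ?W < f W" if out: "\<not> nbrs v \<subseteq> W"
    proof -
      have "card ?N < card (nbrs v)" using finv out by (intro psubset_card_mono) auto
      \<comment> \<open>A neighbour outside \<open>W\<close> makes the coefficient of
        \<open>f ?W\<close> at least 1. Strictness then comes from \<open>t > 0\<close>, from degree
        at least 2, or from a nonempty sum.\<close>
      then have k1: "k \<ge> 1" unfolding k_def a_def by simp
      show ?thesis
      proof (cases "t > 0 \<or> ?N = {}")
        case True
        then have "t + k > 1" using t2 t k1 unfolding k_def by auto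
        then have "1 * f ?W < (t + k) * f ?W" using IH(1) by (intro mult_strict_right_mono)
        then show ?thesis using e sum0 by simp
      next
        case False
        then show ?thesis using e sum1 mono[of 1] t k1 by simp
      qed
    qed
    ultimately show ?thesis by simp
  qed
  show ?case
  proof (cases "W = {}")
    case True then show ?thesis by (simp add: f_def match_poly_empty)
  next
    case False then show ?thesis using step by blast
  qed
qed

section \<open>Partial fractions of vertex-deleted quotients and roots along paths\<close>

text \<open>\<open>Z\<close> consists of the poles of the quotient of the polynomials for
  \<open>W - {v}\<close> and \<open>W\<close>. Roots that cancel in the quotient are absent from it,
  and the product form of the identity remains valid at them. Counting poles rather than all roots
  lets every step along a path add one.\<close>

lemma match_poly_ratio:
  assumes "finite W" "v \<in> W"
  shows "\<exists>Z w. finite Z \<and> (\<forall>z\<in>Z. w z > 0 \<and> poly (match_poly a W) z = 0) \<and>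
    (\<forall>x. x \<notin> Z \<longrightarrow> poly (match_poly a (W - {v})) x = poly (match_poly a W) x * (\<Sum>z\<in>Z. w z / (x - z))) \<and>
    (\<forall>p. distinct (v # p) \<and> set p \<subseteq> W \<and> successively (\<lambda>u u'. u' \<in> nbrs u) (v # p) \<longrightarrow>
      length (v # p) \<le> card Z)"
  using assms
proof (induction "card W" arbitrary: W v rule: less_induct)
  case less
  let ?W = "W - {v}" and ?N = "nbrs v \<inter> W"
  have fin: "finite ?W" "finite ?N" using less.prems by auto
  have "card ?W < card W" using less.prems by (intro psubset_card_mono) auto
  moreover have "u \<in> ?W" if "u \<in> ?N" for u using that nbrs_irrefl by auto
  ultimately have "\<forall>u\<in>?N. \<exists>Z w. finite Z \<and> (\<forall>z\<in>Z. w z > 0 \<and> poly (match_poly a ?W) z = 0) \<and>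
    (\<forall>x. x \<notin> Z \<longrightarrow> poly (match_poly a (?W - {u})) x = poly (match_poly a ?W) x * (\<Sum>z\<in>Z. w z / (x - z))) \<and>
    (\<forall>p. distinct (u # p) \<and> set p \<subseteq> ?W \<and> successively (\<lambda>u u'. u' \<in> nbrs u) (u # p) \<longrightarrow>
      length (u # p) \<le> card Z)"
    using less.hyps[of ?W] fin by blast
  then obtain Z w where Zw: "\<forall>u\<in>?N. finite (Z u) \<and> (\<forall>z\<in>Z u. w u z > 0 \<and> poly (match_poly a ?W) z = 0) \<and>
    (\<forall>x. x \<notin> Z u \<longrightarrow> poly (match_poly a (?W - {u})) x = poly (match_poly a ?W) x * (\<Sum>z\<in>Z u. w u z / (x - z))) \<and>
    (\<forall>p. distinct (u # p) \<and> set p \<subseteq> ?W \<and> successively (\<lambda>u u'. u' \<in> nbrs u) (u # p) \<longrightarrow>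
      length (u # p) \<le> card (Z u))"
    unfolding bchoice_iff by blast
  define S where "S = (\<Union>u\<in>?N. Z u)"
  define m where "m s = (\<Sum>u\<in>?N. if s \<in> Z u then w u s else 0)" for s
  have finS: "finite S" unfolding S_def using Zw fin by blast
  have m: "m s > 0" if s: "s \<in> S" for s
  proof -
    obtain u where u: "u \<in> ?N" "s \<in> Z u" using s by (auto simp: S_def)
    show ?thesis unfolding m_def
    proof (rule sum_pos2[OF fin(2) u(1)])
      show "0 < (if s \<in> Z u then w u s else 0)" using Zw u by auto
      show "0 \<le> (if s \<in> Z i then w i s else 0)" if "i \<in> ?N" for i
        using Zw that by (auto simp: less_imp_le)
    qed
  qed
  obtain T r where T: "finite T" "card T = Suc (card S)" "T \<inter> S = {}"
    and r: "\<And>z. z \<in> T \<Longrightarrow> r z > 0" "\<And>z. z \<in> T \<Longrightarrow> pick (a v) m S z = 0"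
    and inv: "\<And>x. x \<notin> S \<union> T \<Longrightarrow> pick (a v) m S x * (\<Sum>z\<in>T. r z / (x - z)) = 1"
    using pick_inverse[of S m "a v", OF finS m] by auto
  \<comment> \<open>This is the vertex recurrence with the factor \<open>match_poly a ?W\<close>
    taken out by the induction hypothesis.\<close>
  have eq: "poly (match_poly a W) x = poly (match_poly a ?W) x * pick (a v) m S x" if x: "x \<notin> S" for x
  proof -
    have "(\<Sum>u\<in>?N. poly (match_poly a (?W - {u})) x)
      = (\<Sum>u\<in>?N. poly (match_poly a ?W) x * (\<Sum>z\<in>S. (if z \<in> Z u then w u z else 0) / (x - z)))"
    proof (rule sum.cong[OF refl])
      fix u assume u: "u \<in> ?N"
      have "x \<notin> Z u" using u x by (auto simp: S_def)
      then have "poly (match_poly a (?W - {u})) x = poly (match_poly a ?W) x * (\<Sum>z\<in>Z u. w u z / (x - z))"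
        using Zw u by auto
      also have "(\<Sum>z\<in>Z u. w u z / (x - z)) = (\<Sum>z\<in>S. (if z \<in> Z u then w u z else 0) / (x - z))"
        by (rule sum.mono_neutral_cong_left[OF finS]) (use u in \<open>auto simp: S_def\<close>)
      finally show "poly (match_poly a (?W - {u})) x
        = poly (match_poly a ?W) x * (\<Sum>z\<in>S. (if z \<in> Z u then w u z else 0) / (x - z))" .
    qed
    also have "\<dots> = poly (match_poly a ?W) x * (\<Sum>u\<in>?N. \<Sum>z\<in>S. (if z \<in> Z u then w u z else 0) / (x - z))"
      by (rule sum_distrib_left[symmetric])
    also have "(\<Sum>u\<in>?N. \<Sum>z\<in>S. (if z \<in> Z u then w u z else 0) / (x - z)) = (\<Sum>z\<in>S. m z / (x - z))"
      unfolding m_def sum_divide_distrib by (rule sum.swap)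
    finally show ?thesis
      by (simp add: match_poly_rec[OF less.prems] poly_sum pick_def algebra_simps)
  qed
  have root: "poly (match_poly a W) z = 0" if "z \<in> T" for z
    using eq[of z] r(2)[OF that] T that by auto
  have quot: "poly (match_poly a ?W) x = poly (match_poly a W) x * (\<Sum>z\<in>T. r z / (x - z))" if x: "x \<notin> T" for x
  \<comment> \<open>The identities \<open>eq\<close> and \<open>inv\<close> give the claim off
    \<open>S \<union> T\<close>; continuity extends it to the points of \<open>S\<close>.\<close>
  proof (rule poly_eq_off_finite[where F = "S \<union> T"])
    show "isCont (\<lambda>x. poly (match_poly a W) x * (\<Sum>z\<in>T. r z / (x - z))) x"
      using x by (intro continuous_intros) auto
    fix y assume y: "y \<notin> S \<union> T"
    show "poly (match_poly a ?W) y = poly (match_poly a W) y * (\<Sum>z\<in>T. r z / (y - z))"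
      using eq[of y] inv[OF y] y by (simp add: mult.assoc)
  qed (use finS T in auto)
  have path: "length (v # p) \<le> card T"
    if p: "distinct (v # p)" "set p \<subseteq> W" "successively (\<lambda>u u'. u' \<in> nbrs u) (v # p)" for p
  proof (cases p)
    case Nil then show ?thesis using T by simp
  next
    case (Cons u q)
    then have u: "u \<in> ?N" using p by auto
    have "distinct (u # q)" "set q \<subseteq> ?W" "successively (\<lambda>u u'. u' \<in> nbrs u) (u # q)"
      using p Cons by auto
    \<comment> \<open>Without \<open>v\<close> the path starts at the neighbour \<open>u\<close> and
      stays in \<open>?W\<close>, so the poles for \<open>u\<close> bound its length. The extra
      element of \<open>T\<close> accounts for \<open>v\<close>.\<close>
    then have "length (u # q) \<le> card (Z u)" using Zw u by blast
    also have "\<dots> \<le> card S" using u by (intro card_mono finS) (auto simp: S_def)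
    finally show ?thesis using T Cons by simp
  qed
  show ?case
    using T(1) r(1) root quot path by (intro exI[of _ T] exI[of _ r]) blast
qed

end

section \<open>Translation from digraphs and the final count\<close>

text \<open>An edge at \<open>v\<close> may come from an arc that enters \<open>v\<close>; symmetry
  then supplies the opposite arc, which leaves \<open>v\<close>.\<close>

lemma (in graph) nbrs_edges_of:
  "{u. {v, u} \<in> edges_of G} = head G ` out_arcs G v"
proof (intro equalityI subsetI)
  fix u assume "u \<in> {u. {v, u} \<in> edges_of G}"
  then obtain e where e: "e \<in> arcs G" "{v, u} = {tail G e, head G e}"
    by (auto simp: edges_of_def)
  obtain e' where "e' \<in> arcs G" "tail G e = head G e'" "head G e = tail G e'"
    using sym_arcs e(1) by (auto simp: symmetric_conv)
  then show "u \<in> head G ` out_arcs G v"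
    using e by (auto simp: doubleton_eq_iff image_iff intro: bexI[of _ e] bexI[of _ e'])
qed (auto simp: edges_of_def)

text \<open>Without parallel arcs, distinct arcs leaving \<open>v\<close> have distinct
  heads.\<close>

lemma (in graph) vertex_degree_eq: "vertex_degree G v = card {u. {v, u} \<in> edges_of G}"
proof -
  have "inj_on (head G) (out_arcs G v)"
    by (rule inj_onI) (auto intro: no_multi_arcs simp: arc_to_ends_def)
  then show ?thesis
    by (simp add: nbrs_edges_of vertex_degree_def out_degree_def card_image)
qed

theorem theorem2p5:
  fixes G :: "('a, 'b) pre_digraph"
  assumes "graph G"
    and "Digraph_Component.connected G"
  shows "longest_path_length G
           \<le> card {x :: real. 0 < x \<and> poly (laplacian_matching_poly G) x = 0} \<and>
         (2 \<le> min_degree G \<longrightarrow>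
           longest_path_length G + 1
             \<le> card {x :: real. 0 < x \<and> poly (laplacian_matching_poly G) x = 0})"
proof -
  interpret graph G by fact
  interpret edge_set "edges_of G"
    by standard (use no_loops in \<open>auto simp: edges_of_def card_2_iff\<close>)
  let ?V = "verts G" and ?LM = "laplacian_matching_poly G"
  have edges: "e \<subseteq> ?V" if "e \<in> edges_of G" for e
    using that by (auto simp: edges_of_def)
  have LM: "?LM = match_poly (\<lambda>v. real (card (nbrs v))) ?V"
  proof -
    have "{M. is_matching G M} = matchings ?V"
      using edges by (auto simp: is_matching_def matchings_def pairwise_def disjnt_def)
    then show ?thesis
      by (simp add: laplacian_matching_poly_def match_poly_def vertex_degree_eq nbrs_def)
  qed
  \<comment> \<open>Positive \<open>t\<close> excludes negative roots; \<open>t = 0\<close> excludes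
    the root 0 when all degrees are at least 2.\<close>
  have nonzero: "poly ?LM (- t) \<noteq> 0"
    if "t \<ge> 0" "t > 0 \<or> (\<forall>v\<in>?V. 2 \<le> card (nbrs v))" for t
  proof -
    have "nbrs v \<subseteq> ?V" for v using edges by (fastforce simp: nbrs_def)
    then show ?thesis using match_poly_nonpos_sign[of ?V t ?V] that by (auto simp: LM)
  qed
  have "?LM \<noteq> 0" using nonzero[of 1] by auto
  then have finR: "finite {x. poly ?LM x = 0}" by (rule poly_roots_finite)
  let ?L = "{vwalk_length p | p. vpath p G}"
  \<comment> \<open>Connectedness supplies a vertex and hence a path of length 0, so the maximum is
    over a nonempty set and is attained.\<close>
  have "?V \<noteq> {}"
    using assms(2) by (auto simp: Digraph_Component.connected_def strongly_connected_def mk_symmetric_def)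
  then obtain v0 where "v0 \<in> ?V" by auto
  then have "vpath [v0] G" by (auto simp: vpath_def vwalk_def)
  then have "?L \<noteq> {}" by blast
  moreover have "finite ?L"
  proof (rule finite_subset)
    show "?L \<subseteq> {..card ?V}"
    proof clarsimp
      fix p assume "vpath p G"
      then have "distinct p" "set p \<subseteq> ?V" by (auto simp: vpath_def vwalk_def)
      then have "length p \<le> card ?V" by (metis card_mono distinct_card finite_verts)
      then show "length p - Suc 0 \<le> card ?V" by simp
    qed
  qed simp
  ultimately have "longest_path_length G \<in> ?L"
    unfolding longest_path_length_def by (intro Max_in)
  then obtain p where p: "vpath p G" "longest_path_length G = vwalk_length p" by auto
  then obtain v q where vq: "p = v # q" by (cases p) (auto simp: vpath_def vwalk_def)
  have in_nbrs: "head G e \<in> nbrs (tail G e)" if "e \<in> arcs G" for e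
  proof -
    have "{tail G e, head G e} \<in> edges_of G" using that by (simp add: edges_of_def)
    then show ?thesis by (simp add: nbrs_def)
  qed
  have "successively (\<lambda>u u'. u' \<in> nbrs u) xs" if "set (vwalk_arcs xs) \<subseteq> arcs_ends G" for xs
    using that
    by (induction xs rule: vwalk_arcs.induct) (auto simp: in_nbrs arcs_ends_conv)
  then have path: "distinct (v # q)" "set q \<subseteq> ?V" "v \<in> ?V" "successively (\<lambda>u u'. u' \<in> nbrs u) (v # q)"
    using p vq by (auto simp: vpath_def vwalk_def)
  then obtain Z where Z: "finite Z" "\<And>z. z \<in> Z \<Longrightarrow> poly ?LM z = 0" "length (v # q) \<le> card Z"
    using match_poly_ratio[of ?V v "\<lambda>v. real (card (nbrs v))"] unfolding LM by auto
  \<comment> \<open>A path has one more vertex than edges. This additional root makes up for 0, the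
    only root in \<open>Z\<close> that may fail to be positive.\<close>
  have len: "longest_path_length G + 1 \<le> card Z" using Z(3) p vq by simp
  have Z0: "z \<ge> 0" if "z \<in> Z" for z
    using nonzero[of "- z"] Z(2)[OF that] by force
  let ?P = "{x. 0 < x \<and> poly ?LM x = 0}"
  have finP: "finite ?P" using finR by (rule rev_finite_subset) auto
  have "card (Z - {0}) \<le> card ?P"
    using Z(2) Z0 by (intro card_mono finP) (force simp: less_le)
  moreover have "card Z \<le> card (Z - {0}) + 1"
    using diff_card_le_card_Diff[of "{0}" Z] by simp
  moreover have "0 \<notin> Z" if "2 \<le> min_degree G"
  proof -
    have "2 \<le> card (nbrs v)" if "v \<in> ?V" for v
    proof -
      have "min_degree G \<le> vertex_degree G v"
        unfolding min_degree_def using that by (intro Min_le) auto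
      then show ?thesis using \<open>2 \<le> min_degree G\<close> by (simp add: vertex_degree_eq nbrs_def)
    qed
    then show ?thesis using nonzero[of 0] Z(2)[of 0] by auto
  qed
  ultimately show ?thesis using len by auto
qed

end
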